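(* Let $n\ge k\ge d\ge 1$ be integers, and let $T(n,k,d)$ denote the maximal number of intersecting pairs in a family $\mathcal{F}$ of $n$ axis-parallel boxes in $\mathbb{R}^d$ with the property that no $k+1$ boxes in $\mathcal{F}$ have a point in common. Then $$T(n,k,d)<\frac{d-1}{2d}\,n^{2}+\frac{2k+d}{2d}\,n.$$
   Context: An axis-parallel box (or box) in $\mathbb{R}^d$ is a product of $d$ bounded intervals, either all open, $(a_1,b_1)\times\cdots\times(a_d,b_d)$, or all closed, $[a_1,b_1]\times\cdots\times[a_d,b_d]$, with $a_i<b_i$ for all $i$. The statement holds both when the boxes of the family are open and when they are closed. An intersecting pair in $\mathcal{F}$ is an unordered pair of elements of $\mathcal{F}$ with nonempty intersection. *)

theory Defs
  imports "HOL-Analysis.Analysis"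
begin

definition open_boxes :: "(real ^ 'd) set set" where
  "open_boxes = {box a b | a b. \<forall>i. a $ i < b $ i}"

definition closed_boxes :: "(real ^ 'd) set set" where
  "closed_boxes = {cbox a b | a b. \<forall>i. a $ i < b $ i}"

lemma box_eq_product_of_intervals:
  "box a b = {x :: real ^ 'd. \<forall>i. x $ i \<in> {a $ i<..<b $ i}}"
  "cbox a b = {x :: real ^ 'd. \<forall>i. x $ i \<in> {a $ i..b $ i}}"
  by (auto simp: mem_box_cart)

definition intersecting_pairs :: "'a set set \<Rightarrow> 'a set set set" where
  "intersecting_pairs F = {P. P \<subseteq> F \<and> card P = 2 \<and> \<Inter>P \<noteq> {}}"

definition admissible_families :: "'a set set \<Rightarrow> nat \<Rightarrow> nat \<Rightarrow> 'a set set set" where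
  "admissible_families \<B> n k =
     {F. F \<subseteq> \<B> \<and> finite F \<and> card F = n \<and> (\<forall>G\<subseteq>F. card G = k + 1 \<longrightarrow> \<Inter>G = {})}"

(* T \<B> n k is the paper's T(n,k,d) when \<B> is the class of open, respectively closed, boxes of
   real ^ 'd with CARD('d) = d.  Max is unspecified on empty or infinite sets; the lemmas below
   show that this does not occur here. *)
definition T :: "'a set set \<Rightarrow> nat \<Rightarrow> nat \<Rightarrow> nat" where
  "T \<B> n k = Max ((\<lambda>F. card (intersecting_pairs F)) ` admissible_families \<B> n k)"

lemma finite_intersecting_pair_counts:
  "finite ((\<lambda>F. card (intersecting_pairs F)) ` admissible_families \<B> n k)"
proof (rule finite_subset)
  show "(\<lambda>F. card (intersecting_pairs F)) ` admissible_families \<B> n k \<subseteq> {..2 ^ n}"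
  proof clarsimp
    fix F assume F: "F \<in> admissible_families \<B> n k"
    then have fin: "finite F" and card: "card F = n"
      by (auto simp: admissible_families_def)
    have "card (intersecting_pairs F) \<le> card (Pow F)"
      using fin by (intro card_mono) (auto simp: intersecting_pairs_def)
    then show "card (intersecting_pairs F) \<le> 2 ^ n"
      using fin card by (simp add: card_Pow)
  qed
qed simp

lemma admissible_families_nonempty_aux:
  fixes B :: "nat \<Rightarrow> 'a set"
  assumes "k \<ge> 1" and "\<And>j. B j \<in> \<B>" and ne: "\<And>j. B j \<noteq> {}"
    and disj: "\<And>i j. i \<noteq> j \<Longrightarrow> B i \<inter> B j = {}"
  shows "admissible_families \<B> n k \<noteq> {}"
proof -
  have inj: "inj B"
    by (rule injI) (metis disj ne inf.idem)
  have "\<Inter>G = {}" if G: "G \<subseteq> B ` {..<n}" "card G = k + 1" for G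
  proof -
    have "\<not> is_singleton G" "G \<noteq> {}"
      using G(2) \<open>k \<ge> 1\<close> by (auto simp: is_singleton_altdef)
    then obtain X Y where "X \<in> G" "Y \<in> G" "X \<noteq> Y"
      by (metis is_singletonI')
    moreover from this obtain i j where "X = B i" "Y = B j"
      using G(1) by blast
    ultimately show ?thesis
      using disj[of i j] by blast
  qed
  then have "B ` {..<n} \<in> admissible_families \<B> n k"
    using assms(2) inj_on_subset[OF inj] by (auto simp: admissible_families_def card_image)
  then show ?thesis by blast
qed

lemma admissible_families_nonempty:
  assumes "k \<ge> 1"
  shows "admissible_families (open_boxes :: (real ^ 'd) set set) n k \<noteq> {}"
    and "admissible_families (closed_boxes :: (real ^ 'd) set set) n k \<noteq> {}"
proof -
  define a b :: "nat \<Rightarrow> real ^ 'd"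
    where "a = (\<lambda>j. \<chi> i. 2 * real j)" and "b = (\<lambda>j. \<chi> i. 2 * real j + 1)"
  have ab: "a j $ i < b j $ i" for i j
    by (simp add: a_def b_def)
  have disj: "cbox (a i) (b i) \<inter> cbox (a j) (b j) = {}" if "i \<noteq> j" for i j
  proof (rule ccontr)
    assume "cbox (a i) (b i) \<inter> cbox (a j) (b j) \<noteq> {}"
    then obtain x :: "real ^ 'd" where "\<forall>l. 2 * real i \<le> x $ l \<and> x $ l \<le> 2 * real i + 1"
      "\<forall>l. 2 * real j \<le> x $ l \<and> x $ l \<le> 2 * real j + 1"
      by (auto simp: mem_box_cart a_def b_def)
    then have "2 * real i \<le> 2 * real j + 1" "2 * real j \<le> 2 * real i + 1"
      by (meson order_trans)+
    then have "i = j" by linarith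
    with that show False by simp
  qed
  have mid: "(\<chi> i. 2 * real j + 1 / 2) \<in> box (a j) (b j)" for j
    by (simp add: mem_box_cart a_def b_def)
  show "admissible_families (open_boxes :: (real ^ 'd) set set) n k \<noteq> {}"
  proof (rule admissible_families_nonempty_aux[where B = "\<lambda>j. box (a j) (b j)"])
    show "box (a j) (b j) \<in> open_boxes" for j
      unfolding open_boxes_def using ab by blast
    show "box (a j) (b j) \<noteq> {}" for j
      using mid by blast
    show "box (a i) (b i) \<inter> box (a j) (b j) = {}" if "i \<noteq> j" for i j
      using disj[OF that] box_subset_cbox by blast
  qed (rule assms)
  show "admissible_families (closed_boxes :: (real ^ 'd) set set) n k \<noteq> {}"
  proof (rule admissible_families_nonempty_aux[where B = "\<lambda>j. cbox (a j) (b j)"])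
    show "cbox (a j) (b j) \<in> closed_boxes" for j
      unfolding closed_boxes_def using ab by blast
    show "cbox (a j) (b j) \<noteq> {}" for j
      using mid box_subset_cbox by blast
    show "cbox (a i) (b i) \<inter> cbox (a j) (b j) = {}" if "i \<noteq> j" for i j
      using disj[OF that] .
  qed (rule assms)
qed

end

theory Submission
  imports Defs
begin

text \<open>
  Why the bound holds. In every coordinate direction \<open>i\<close> pick a box \<open>D i\<close> of the family whose
  upper endpoint \<open>u i\<close> in that direction is smallest. A box that meets \<open>D i\<close> starts before \<open>u i\<close> in
  direction \<open>i\<close>, and it ends no earlier than \<open>u i\<close> by minimality. So the boxes that meet all of the
  \<open>D i\<close> have a point in common: \<open>u\<close> itself for closed boxes, a point slightly below it for open
  ones. By hypothesis there are at most \<open>k\<close> of them. The set \<open>M\<close> of the boxes \<open>D i\<close> is a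
  \<^emph>\<open>pierced core\<close> (\<open>pierced_core_closed_boxes\<close>, \<open>pierced_core_open_boxes\<close>) of size \<open>m \<le> d\<close>; the
  size may be smaller than \<open>d\<close> because one box can be extremal in several directions.

  Now delete \<open>M\<close>. Each of the \<open>n - m\<close> remaining boxes meets at most \<open>m - 1\<close> members of \<open>M\<close>, apart
  from at most \<open>k\<close> boxes that meet all \<open>m\<close>. Hence at most
  \<open>(m - 1) (n - m) + k + m (m - 1) / 2\<close> intersecting pairs disappear
  (\<open>card_intersecting_pairs_remove_core\<close>). Repeating this until at most \<open>k\<close> boxes are left, where the
  trivial bound \<open>n (n - 1) / 2\<close> is good enough, gives
  \<open>2 d e \<le> (d - 1) n\<^sup>2 + (2 k + d - 1) n\<close> for the number \<open>e\<close> of intersecting pairs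
  (\<open>intersecting_pairs_bound\<close>). This is better than the claim by \<open>n / (2 d)\<close>, which makes the
  inequality strict for nonempty families.
\<close>

section \<open>Families with pierced cores\<close>

text \<open>This notion isolates the geometry: the counting needs a small pierced core in every nonempty
  finite subfamily, because cores are deleted one after the other, and nothing else about boxes.\<close>

definition pierced_core :: "'a set set \<Rightarrow> 'a set set \<Rightarrow> bool" where
  "pierced_core H M \<longleftrightarrow> M \<subseteq> H \<and> M \<noteq> {} \<and> \<Inter>{C \<in> H. \<forall>D\<in>M. C \<inter> D \<noteq> {}} \<noteq> {}"

lemma card_le_of_common_point:
  assumes "F \<in> admissible_families \<B> n k" "G \<subseteq> F" "\<Inter>G \<noteq> {}"
  shows "card G \<le> k"
proof (rule ccontr)
  assume "\<not> card G \<le> k"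
  then obtain G' where "G' \<subseteq> G" "card G' = k + 1"
    by (metis Suc_eq_plus1 not_less_eq_eq obtain_subset_with_card_n)
  then have "\<Inter>G' = {}"
    using assms by (auto simp: admissible_families_def)
  moreover have "\<Inter>G \<subseteq> \<Inter>G'"
    using \<open>G' \<subseteq> G\<close> by (rule Inter_anti_mono)
  ultimately show False
    using assms(3) by blast
qed

lemma admissible_families_diff:
  assumes "F \<in> admissible_families \<B> n k" "M \<subseteq> F"
  shows "F - M \<in> admissible_families \<B> (n - card M) k"
  using assms finite_subset[OF assms(2)]
  by (auto simp: admissible_families_def card_Diff_subset)

lemma card_intersecting_pairs_le_choose:
  assumes "finite F"
  shows "card (intersecting_pairs F) \<le> card F choose 2"
proof -
  have "card (intersecting_pairs F) \<le> card {P. P \<subseteq> F \<and> card P = 2}"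
    using assms by (intro card_mono) (auto simp: intersecting_pairs_def)
  then show ?thesis
    using n_subsets[OF assms] by simp
qed

text \<open>Pairs with exactly one member in \<open>M\<close> are counted from their member outside \<open>M\<close>: it meets all
  of \<open>M\<close> in at most \<open>k\<close> cases and misses some member of \<open>M\<close> otherwise.\<close>

lemma card_intersecting_pairs_remove_core:
  assumes F: "F \<in> admissible_families \<B> n k" and M: "pierced_core F M"
  shows "card (intersecting_pairs F) \<le>
    card (intersecting_pairs (F - M)) + (card M choose 2) + (card M - 1) * (n - card M) + k"
proof -
  have finF: "finite F" and cardF: "card F = n"
    using F by (auto simp: admissible_families_def)
  have MF: "M \<subseteq> F" and "M \<noteq> {}" and common: "\<Inter>{C \<in> F. \<forall>D\<in>M. C \<inter> D \<noteq> {}} \<noteq> {}"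
    using M by (auto simp: pierced_core_def)
  have finM: "finite M"
    using MF finF by (rule finite_subset)
  have posM: "card M \<ge> 1"
    using finM \<open>M \<noteq> {}\<close> by (simp add: Suc_leI card_gt_0_iff)
  define nbrs where "nbrs C = {D \<in> M. C \<inter> D \<noteq> {}}" for C
  define mixed where "mixed = (\<Union>C\<in>F - M. (\<lambda>D. {C, D}) ` nbrs C)"
  define meet_all where "meet_all = {C \<in> F - M. nbrs C = M}"
  have finN: "finite (nbrs C)" for C
    using finM by (simp add: nbrs_def)

  have split: "intersecting_pairs F \<subseteq>
      intersecting_pairs (F - M) \<union> intersecting_pairs M \<union> mixed"
  proof
    fix P assume "P \<in> intersecting_pairs F"
    then have "card P = 2" "P \<subseteq> F" "\<Inter>P \<noteq> {}"
      by (auto simp: intersecting_pairs_def)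
    then obtain C D where "P = {C, D}" "C \<noteq> D"
      by (meson card_2_iff)
    with \<open>P \<subseteq> F\<close> \<open>\<Inter>P \<noteq> {}\<close>
    have P: "P = {C, D}" "C \<in> F" "D \<in> F" "C \<inter> D \<noteq> {}"
      by simp_all
    show "P \<in> intersecting_pairs (F - M) \<union> intersecting_pairs M \<union> mixed"
    proof (cases "C \<in> M \<longleftrightarrow> D \<in> M")
      case True
      then have "P \<subseteq> F - M \<or> P \<subseteq> M"
        using P by blast
      then show ?thesis
        using \<open>P \<in> intersecting_pairs F\<close> by (auto simp: intersecting_pairs_def)
    next
      case False
      then obtain X Y where "P = {X, Y}" "X \<in> F - M" "Y \<in> M" "X \<inter> Y \<noteq> {}"
        using P by (metis DiffI inf_commute insert_commute)
      then show ?thesis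
        unfolding mixed_def nbrs_def by blast
    qed
  qed
  have fin_pairs: "finite (intersecting_pairs H)" if "H \<subseteq> F" for H
    by (rule finite_subset[of _ "Pow F"]) (use that finF in \<open>auto simp: intersecting_pairs_def\<close>)
  have fin_mixed: "finite mixed"
    using finF finN by (simp add: mixed_def)

  have "meet_all \<subseteq> {C \<in> F. \<forall>D\<in>M. C \<inter> D \<noteq> {}}"
    by (auto simp: meet_all_def nbrs_def)
  then have "\<Inter>{C \<in> F. \<forall>D\<in>M. C \<inter> D \<noteq> {}} \<subseteq> \<Inter>meet_all"
    by (rule Inter_anti_mono)
  then have "\<Inter>meet_all \<noteq> {}"
    using common by (auto simp only: subset_empty)
  moreover have "meet_all \<subseteq> F"
    by (auto simp: meet_all_def)
  ultimately have all_le: "card meet_all \<le> k"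
    by (intro card_le_of_common_point[OF F])
  have nbrs_le: "card (nbrs C) \<le> (card M - 1) + (if C \<in> meet_all then 1 else 0)"
    if "C \<in> F - M" for C
  proof (cases "nbrs C = M")
    case True
    then show ?thesis
      using that posM by (simp add: meet_all_def)
  next
    case False
    then have "nbrs C \<subset> M"
      by (auto simp: nbrs_def)
    then have "card (nbrs C) < card M"
      using finM by (rule psubset_card_mono[rotated])
    then show ?thesis by simp
  qed
  have "card mixed \<le> (\<Sum>C\<in>F - M. card ((\<lambda>D. {C, D}) ` nbrs C))"
    unfolding mixed_def using finF by (intro card_UN_le) simp
  also have "\<dots> \<le> (\<Sum>C\<in>F - M. card (nbrs C))"
    using finN by (intro sum_mono card_image_le)
  also have "\<dots> \<le> (\<Sum>C\<in>F - M. (card M - 1) + (if C \<in> meet_all then 1 else 0))"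
    by (intro sum_mono nbrs_le)
  also have "\<dots> = card (F - M) * (card M - 1) + card ((F - M) \<inter> meet_all)"
    using finF by (simp add: sum.distrib sum.If_cases)
  also have "(F - M) \<inter> meet_all = meet_all"
    by (auto simp: meet_all_def)
  finally have mixed_le: "card mixed \<le> (card M - 1) * (n - card M) + k"
    using all_le cardF by (simp add: card_Diff_subset[OF finM MF] mult.commute)

  have "card (intersecting_pairs F) \<le>
      card (intersecting_pairs (F - M) \<union> intersecting_pairs M \<union> mixed)"
    using split fin_pairs[of "F - M"] fin_pairs[OF MF] fin_mixed by (intro card_mono) auto
  also have "\<dots> \<le> card (intersecting_pairs (F - M)) + card (intersecting_pairs M) + card mixed"
    by (meson add_mono card_Un_le le_refl order_trans)
  finally show ?thesis
    using mixed_le card_intersecting_pairs_le_choose[OF finM] by linarith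
qed

section \<open>The counting bound\<close>

lemma real_choose_2: "real (n choose 2) = real n * (real n - 1) / 2"
proof -
  have "2 * (n choose 2) = n * (n - 1)"
    by (cases n) (simp_all add: choose_two)
  then have "2 * real (n choose 2) = real n * real (n - 1)"
    by (metis of_nat_mult of_nat_numeral)
  then show ?thesis
    by (cases n) auto
qed

text \<open>Deleting a core of size \<open>m\<close> makes the right-hand side drop by at least as much as the left-hand
  side, with slack \<open>2 (n - k) (d - m) + m (m - 1)\<close>. For \<open>m < d\<close> the slack can be
  negative once \<open>n < k\<close>, and this is why the induction stops at \<open>n \<le> k\<close>.\<close>

lemma intersecting_pairs_bound:
  fixes d k :: nat
  assumes "F \<in> admissible_families \<B> n k" and "d \<ge> 1"
    and core: "\<And>H. finite H \<Longrightarrow> H \<noteq> {} \<Longrightarrow> H \<subseteq> \<B> \<Longrightarrow> \<exists>M. pierced_core H M \<and> card M \<le> d"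
  shows "2 * real d * real (card (intersecting_pairs F))
    \<le> (real d - 1) * (real n)\<^sup>2 + (2 * real k + real d - 1) * real n"
  using assms(1)
proof (induction n arbitrary: F rule: less_induct)
  case (less n)
  have finF: "finite F" and cardF: "card F = n" and FB: "F \<subseteq> \<B>"
    using less.prems by (auto simp: admissible_families_def)
  have d: "real d \<ge> 1"
    using \<open>d \<ge> 1\<close> by simp
  show ?case
  proof (cases "n \<le> k")
    case True
    have "real (card (intersecting_pairs F)) \<le> real n * (real n - 1) / 2"
      using card_intersecting_pairs_le_choose[OF finF] cardF
      by (metis of_nat_le_iff real_choose_2)
    then have "2 * real d * real (card (intersecting_pairs F))
        \<le> 2 * real d * (real n * (real n - 1) / 2)"
      by (rule mult_left_mono) simp
    also have "\<dots> = (real d - 1) * (real n)\<^sup>2 + (2 * real k + real d - 1) * real n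
        - real n * (2 * (real k - real n) + real n + (2 * real d - 1))"
      by (simp add: field_simps power2_eq_square)
    also have "\<dots> \<le> (real d - 1) * (real n)\<^sup>2 + (2 * real k + real d - 1) * real n"
    proof -
      have "0 \<le> real n * (2 * (real k - real n) + real n + (2 * real d - 1))"
        using True d by (intro mult_nonneg_nonneg) auto
      then show ?thesis by linarith
    qed
    finally show ?thesis .
  next
    case False
    then have "F \<noteq> {}"
      using cardF by auto
    then obtain M where M: "pierced_core F M" and md: "card M \<le> d"
      using core finF FB by blast
    define m where "m = card M"
    have MF: "M \<subseteq> F" and "M \<noteq> {}"
      using M by (auto simp: pierced_core_def)
    then have m: "1 \<le> m" "m \<le> n"
      using finF cardF finite_subset[OF MF finF]
      by (auto simp: m_def Suc_leI card_gt_0_iff intro: card_mono)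
    define e e' where "e = real (card (intersecting_pairs F))"
      and "e' = real (card (intersecting_pairs (F - M)))"
    have IH: "2 * real d * e' \<le> (real d - 1) * (real n - real m)\<^sup>2
        + (2 * real k + real d - 1) * (real n - real m)"
      using less.IH[OF _ admissible_families_diff[OF less.prems MF]] m
      by (simp add: e'_def flip: m_def)
    have "e \<le> real (card (intersecting_pairs (F - M)) + (m choose 2) + (m - 1) * (n - m) + k)"
      unfolding e_def m_def of_nat_le_iff
      by (rule card_intersecting_pairs_remove_core[OF less.prems M])
    also have "\<dots> = e' + real m * (real m - 1) / 2 + (real m - 1) * (real n - real m) + real k"
      using m by (simp add: e'_def real_choose_2)
    finally have "2 * real d * e
        \<le> 2 * real d * (e' + real m * (real m - 1) / 2 + (real m - 1) * (real n - real m) + real k)"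
      by (rule mult_left_mono) simp
    also have "\<dots> = 2 * real d * e' + real d * real m * (real m - 1)
        + 2 * real d * (real m - 1) * (real n - real m) + 2 * real d * real k"
      by (simp add: field_simps)
    also have "\<dots> \<le> (real d - 1) * (real n - real m)\<^sup>2
        + (2 * real k + real d - 1) * (real n - real m) + real d * real m * (real m - 1)
        + 2 * real d * (real m - 1) * (real n - real m) + 2 * real d * real k"
      using IH by simp
    also have "\<dots> = (real d - 1) * (real n)\<^sup>2 + (2 * real k + real d - 1) * real n
        - (2 * (real n - real k) * (real d - real m) + real m * (real m - 1))"
      by (simp add: algebra_simps power2_eq_square)
    also have "\<dots> \<le> (real d - 1) * (real n)\<^sup>2 + (2 * real k + real d - 1) * real n"
    proof -
      have "0 \<le> 2 * (real n - real k) * (real d - real m)" "0 \<le> real m * (real m - 1)"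
        using False md m by (auto simp: m_def)
      then show ?thesis by linarith
    qed
    finally show ?thesis
      by (simp add: e_def)
  qed
qed

section \<open>Pierced cores of families of boxes\<close>

lemma smallest_upper_corners:
  fixes b :: "'a \<Rightarrow> real ^ 'd"
  assumes "finite H" "H \<noteq> {}"
  obtains D :: "'d \<Rightarrow> 'a" where "\<And>i. D i \<in> H" "\<And>i C. C \<in> H \<Longrightarrow> b (D i) $ i \<le> b C $ i"
proof
  let ?D = "\<lambda>i. arg_min_on (\<lambda>C. b C $ i) H"
  show "?D i \<in> H" for i
    using arg_min_if_finite(1)[OF assms] .
  show "b (?D i) $ i \<le> b C $ i" if "C \<in> H" for i C
    using arg_min_least[OF assms that] .
qed

lemma pierced_core_closed_boxes:
  fixes H :: "(real ^ 'd) set set"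
  assumes "finite H" "H \<noteq> {}" "H \<subseteq> closed_boxes"
  shows "\<exists>M. pierced_core H M \<and> card M \<le> CARD('d)"
proof -
  have "\<forall>C\<in>H. \<exists>a b. C = cbox a b"
    using assms(3) unfolding closed_boxes_def by blast
  then obtain a b where ab: "\<And>C. C \<in> H \<Longrightarrow> C = cbox (a C) (b C)"
    by metis
  obtain D where D: "\<And>i. D i \<in> H" and least: "\<And>i C. C \<in> H \<Longrightarrow> b (D i) $ i \<le> b C $ i"
    using smallest_upper_corners[OF assms(1,2)] by blast
  have "(\<chi> i. b (D i) $ i) \<in> C" if C: "C \<in> H" and meets: "\<forall>i. C \<inter> D i \<noteq> {}" for C
  proof -
    have "a C $ i \<le> b (D i) $ i" for i
    proof -
      obtain x where "x \<in> C" "x \<in> D i"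
        using meets by blast
      then have "x \<in> cbox (a C) (b C)" "x \<in> cbox (a (D i)) (b (D i))"
        using ab[OF C] ab[OF D] by auto
      then show ?thesis
        by (meson mem_box_cart(2) order_trans)
    qed
    then have "(\<chi> i. b (D i) $ i) \<in> cbox (a C) (b C)"
      using least[OF C] by (simp add: mem_box_cart)
    then show ?thesis
      using ab[OF C] by simp
  qed
  then have "(\<chi> i. b (D i) $ i) \<in> \<Inter>{C \<in> H. \<forall>E\<in>range D. C \<inter> E \<noteq> {}}"
    by simp
  then have "pierced_core H (range D)"
    using D unfolding pierced_core_def by blast
  then show ?thesis
    using card_image_le[OF finite_class.finite_UNIV, of D] by blast
qed

text \<open>An open box excludes its upper endpoints, so the point \<open>u\<close> of smallest upper endpoints is
  replaced by a point with smaller coordinates. Since the family is finite, coordinate \<open>i\<close> can stay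
  above all lower endpoints that are smaller than \<open>u i\<close>.\<close>

lemma pierced_core_open_boxes:
  fixes H :: "(real ^ 'd) set set"
  assumes "finite H" "H \<noteq> {}" "H \<subseteq> open_boxes"
  shows "\<exists>M. pierced_core H M \<and> card M \<le> CARD('d)"
proof -
  have "\<forall>C\<in>H. \<exists>a b. C = box a b"
    using assms(3) unfolding open_boxes_def by blast
  then obtain a b where ab: "\<And>C. C \<in> H \<Longrightarrow> C = box (a C) (b C)"
    by metis
  obtain D where D: "\<And>i. D i \<in> H" and least: "\<And>i C. C \<in> H \<Longrightarrow> b (D i) $ i \<le> b C $ i"
    using smallest_upper_corners[OF assms(1,2)] by blast
  have "\<exists>p. p < b (D i) $ i \<and> (\<forall>C\<in>H. a C $ i < b (D i) $ i \<longrightarrow> a C $ i < p)" for i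
  proof -
    \<comment> \<open>The extra element makes \<open>?L\<close> nonempty without appeal to \<open>a (D i) $ i < b (D i) $ i\<close>.\<close>
    let ?L = "insert (b (D i) $ i - 1) ((\<lambda>C. a C $ i) ` {C \<in> H. a C $ i < b (D i) $ i})"
    have fin: "finite ?L"
      using assms(1) by simp
    then have "Max ?L < b (D i) $ i"
      by (subst Max_less_iff) auto
    then obtain p where p: "Max ?L < p" "p < b (D i) $ i"
      using dense by blast
    have "\<forall>l\<in>?L. l < p"
      using p(1) fin by (subst (asm) Max_less_iff) auto
    then show ?thesis
      using p(2) by auto
  qed
  then obtain p where p: "\<And>i. p i < b (D i) $ i"
    and above: "\<And>i C. C \<in> H \<Longrightarrow> a C $ i < b (D i) $ i \<Longrightarrow> a C $ i < p i"
    by metis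
  have "(\<chi> i. p i) \<in> C" if C: "C \<in> H" and meets: "\<forall>i. C \<inter> D i \<noteq> {}" for C
  proof -
    have "a C $ i < b (D i) $ i" for i
    proof -
      obtain x where "x \<in> C" "x \<in> D i"
        using meets by blast
      then have "x \<in> box (a C) (b C)" "x \<in> box (a (D i)) (b (D i))"
        using ab[OF C] ab[OF D] by auto
      then show ?thesis
        by (meson mem_box_cart(1) less_trans)
    qed
    then have "(\<chi> i. p i) \<in> box (a C) (b C)"
      using above[OF C] less_le_trans[OF p least[OF C]] by (simp add: mem_box_cart)
    then show ?thesis
      using ab[OF C] by simp
  qed
  then have "(\<chi> i. p i) \<in> \<Inter>{C \<in> H. \<forall>E\<in>range D. C \<inter> E \<noteq> {}}"
    by simp
  then have "pierced_core H (range D)"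
    using D unfolding pierced_core_def by blast
  then show ?thesis
    using card_image_le[OF finite_class.finite_UNIV, of D] by blast
qed

section \<open>The maximal number of intersecting pairs\<close>

lemma T_less_if_pierced_cores:
  fixes n k d :: nat
  assumes "n \<ge> 1" "d \<ge> 1" and ne: "admissible_families \<B> n k \<noteq> {}"
    and core: "\<And>H. finite H \<Longrightarrow> H \<noteq> {} \<Longrightarrow> H \<subseteq> \<B> \<Longrightarrow> \<exists>M. pierced_core H M \<and> card M \<le> d"
  shows "real (T \<B> n k)
    < (real d - 1) / (2 * real d) * (real n)\<^sup>2 + (2 * real k + real d) / (2 * real d) * real n"
proof -
  have "T \<B> n k \<in> (\<lambda>F. card (intersecting_pairs F)) ` admissible_families \<B> n k"
    unfolding T_def using ne by (intro Max_in finite_intersecting_pair_counts) simp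
  then obtain F where F: "F \<in> admissible_families \<B> n k" "T \<B> n k = card (intersecting_pairs F)"
    by blast
  have "2 * real d * real (T \<B> n k)
      \<le> (real d - 1) * (real n)\<^sup>2 + (2 * real k + real d - 1) * real n"
    unfolding F(2) using F(1) assms(2) core by (rule intersecting_pairs_bound)
  also have "\<dots> < (real d - 1) * (real n)\<^sup>2 + (2 * real k + real d) * real n"
    using assms(1) by simp
  finally have "real (T \<B> n k)
      < ((real d - 1) * (real n)\<^sup>2 + (2 * real k + real d) * real n) / (2 * real d)"
    using assms(2) by (simp add: pos_less_divide_eq mult.commute)
  then show ?thesis
    by (simp add: add_divide_distrib[of "_ * _" "_ * _"])
qed

theorem theorem1:
  fixes n k d :: nat
  assumes "n \<ge> k" and "k \<ge> d" and "d \<ge> 1" and "CARD('d::finite) = d"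
  shows "real (T (open_boxes :: (real ^ 'd) set set) n k)
           < (real d - 1) / (2 * real d) * (real n)\<^sup>2 + (2 * real k + real d) / (2 * real d) * real n
         \<and> real (T (closed_boxes :: (real ^ 'd) set set) n k)
           < (real d - 1) / (2 * real d) * (real n)\<^sup>2 + (2 * real k + real d) / (2 * real d) * real n"
proof -
  have "n \<ge> 1" "k \<ge> 1"
    using assms by auto
  then show ?thesis
    using assms(3) admissible_families_nonempty[where 'd = 'd]
      pierced_core_open_boxes[where 'd = 'd] pierced_core_closed_boxes[where 'd = 'd]
    unfolding assms(4) by (intro conjI T_less_if_pierced_cores) auto
qed

end
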